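(* The numerical dispersion relation of the Leapfrog scheme $$ \frac{i}{2\tau}(u^{n+1}-u^{n-1})=-\frac14\bigl(\Delta u^{n+1}+2\Delta u^n+\Delta u^{n-1}\bigr)+\frac{\lambda}{8}\Bigl(\Bigl|\frac{u^n+u^{n-1}}{2}\Bigr|^2+\Bigl|\frac{u^{n+1}+u^n}{2}\Bigr|^2\Bigr)\bigl(u^{n+1}+2u^n+u^{n-1}\bigr) $$ for the cubic nonlinear Schrödinger equation $iu_t+\Delta u=\lambda|u|^2u$ is given by $$ \frac{2}{\tau}\sin(\tilde\omega\tau/2)=\bigl(k^2+\lambda\cos^2(\tilde\omega\tau/2)\bigr)\cos(\tilde\omega\tau/2). $$
   Context: Here $\lambda=\pm1$, $i=\sqrt{-1}$, $\tau>0$ is the time step and $u^n$ approximates $u$ at time $n\tau$. The numerical dispersion relation of a time-stepping scheme is the relation between the wave number $k$ and the numerical angular frequency $\tilde\omega$ obtained by substituting the discrete plane wave solution $u^n=e^{i(kx-\tilde\omega n\tau)}$ into the scheme.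
   Formalization: The dispersion relation is identified with the displayed formula only where cos(ω̃τ/2) ≠ 0; when cos(ω̃τ/2) = 0 (e.g. ω̃ = π/τ) the plane wave solves the scheme for every k although the formula fails, and these modes are stated separately. *)

theory Defs
  imports "HOL-Analysis.Analysis"
begin

definition partial_deriv :: "'a::euclidean_space \<Rightarrow> ('a \<Rightarrow> complex) \<Rightarrow> 'a \<Rightarrow> complex" where
  "partial_deriv b f x = vector_derivative (\<lambda>t. f (x + t *\<^sub>R b)) (at 0)"

definition laplacian :: "('a::euclidean_space \<Rightarrow> complex) \<Rightarrow> 'a \<Rightarrow> complex" where
  "laplacian f x = (\<Sum>b\<in>Basis. partial_deriv b (partial_deriv b f) x)"

definition leapfrog_scheme :: "real \<Rightarrow> real \<Rightarrow> (nat \<Rightarrow> 'a::euclidean_space \<Rightarrow> complex) \<Rightarrow> bool" where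
  "leapfrog_scheme lam \<tau> u \<longleftrightarrow>
    (\<forall>n\<ge>1. \<forall>x.
      \<i> / (2 * of_real \<tau>) * (u (n + 1) x - u (n - 1) x) =
        - (1 / 4) * (laplacian (u (n + 1)) x + 2 * laplacian (u n) x + laplacian (u (n - 1)) x)
        + of_real (lam / 8)
            * of_real ((cmod ((u n x + u (n - 1) x) / 2))\<^sup>2 + (cmod ((u (n + 1) x + u n x) / 2))\<^sup>2)
            * (u (n + 1) x + 2 * u n x + u (n - 1) x))"

text \<open>The phase \<open>k x\<close> is the inner product of the wave vector with the position, so that one space
  dimension, with a scalar wave number, is the instance \<open>'a = real\<close>.\<close>

definition discrete_plane_wave ::
    "real \<Rightarrow> 'a::euclidean_space \<Rightarrow> real \<Rightarrow> nat \<Rightarrow> 'a \<Rightarrow> complex" where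
  "discrete_plane_wave \<tau> k \<omega> n x = exp (\<i> * of_real (k \<bullet> x - \<omega> * real n * \<tau>))"

definition numerical_dispersion_relation ::
    "((nat \<Rightarrow> 'a::euclidean_space \<Rightarrow> complex) \<Rightarrow> bool) \<Rightarrow> real \<Rightarrow> ('a \<times> real) set" where
  "numerical_dispersion_relation scheme \<tau> = {(k, \<omega>). scheme (discrete_plane_wave \<tau> k \<omega>)}"

end

theory Submission
  imports Defs
begin

text \<open>Write \<open>\<theta> = \<omega> \<tau> / 2\<close>. One time step multiplies the plane wave by the phase \<open>exp (-2 \<i> \<theta>)\<close>, and the
  Laplacian multiplies it by \<open>- \<bar>k\<bar>\<^sup>2\<close>. Consequently every term of the scheme, including the cubic one
  because the wave has modulus one, is a real scalar times the nonvanishing value \<open>u\<^sup>n x\<close>: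
  the difference \<open>u\<^sup>n\<^sup>+\<^sup>1 - u\<^sup>n\<^sup>-\<^sup>1\<close> contributes \<open>sin (2 \<theta>) / \<tau> = (2 / \<tau>) sin \<theta> cos \<theta>\<close>, the weighted
  sum \<open>u\<^sup>n\<^sup>+\<^sup>1 + 2 u\<^sup>n + u\<^sup>n\<^sup>-\<^sup>1\<close> contributes \<open>4 cos\<^sup>2 \<theta>\<close>, and each two-level average has squared modulus
  \<open>cos\<^sup>2 \<theta>\<close>. The scheme thus reduces to one real equation, which is the dispersion relation
  multiplied by \<open>cos \<theta>\<close> (\<open>leapfrog_discrete_plane_wave_iff\<close>).

  The extra factor explains the shape of the theorem. The modes with \<open>cos \<theta> = 0\<close> (where
  \<open>u\<^sup>n\<^sup>+\<^sup>1 = - u\<^sup>n\<close>) always solve the scheme, while they never satisfy the relation itself, since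
  \<open>sin \<theta>\<close> and \<open>cos \<theta>\<close> do not vanish together. For all other modes the factor can be cancelled.\<close>

lemma partial_deriv_plane_wave:
  "partial_deriv b (\<lambda>x. a * exp (\<i> * of_real (k \<bullet> x - c))) =
   (\<lambda>x. (\<i> * of_real (k \<bullet> b) * a) * exp (\<i> * of_real (k \<bullet> x - c)))"
proof
  fix x :: 'a
  have "((\<lambda>t. a * exp (\<i> * of_real (k \<bullet> (x + t *\<^sub>R b) - c))) has_vector_derivative
      (\<i> * of_real (k \<bullet> b) * a) * exp (\<i> * of_real (k \<bullet> x - c))) (at 0)"
    by (auto simp: inner_add_right scaleR_conv_of_real algebra_simps
             intro!: derivative_eq_intros has_vector_derivative_real_field)
  then show "partial_deriv b (\<lambda>x. a * exp (\<i> * of_real (k \<bullet> x - c))) x =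
      (\<i> * of_real (k \<bullet> b) * a) * exp (\<i> * of_real (k \<bullet> x - c))"
    unfolding partial_deriv_def by (rule vector_derivative_at)
qed

text \<open>Plane waves are eigenfunctions: each coordinate direction \<open>b\<close> contributes \<open>(\<i> (k \<bullet> b))\<^sup>2\<close>, and
  these add up to \<open>- \<bar>k\<bar>\<^sup>2\<close> because the basis is orthonormal.\<close>

lemma laplacian_discrete_plane_wave:
  "laplacian (discrete_plane_wave \<tau> k \<omega> n) x =
   - of_real ((norm k)\<^sup>2) * discrete_plane_wave \<tau> k \<omega> n x"
proof -
  let ?c = "\<omega> * real n * \<tau>"
  let ?e = "\<lambda>x. exp (\<i> * of_real (k \<bullet> x - ?c))"
  have wave: "discrete_plane_wave \<tau> k \<omega> n = (\<lambda>x. 1 * ?e x)"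
    by (simp add: discrete_plane_wave_def fun_eq_iff)
  have "laplacian (discrete_plane_wave \<tau> k \<omega> n) x =
      (\<Sum>b\<in>Basis. (\<i> * of_real (k \<bullet> b) * (\<i> * of_real (k \<bullet> b) * 1)) * ?e x)"
    unfolding laplacian_def wave partial_deriv_plane_wave ..
  also have "\<dots> = (\<Sum>b\<in>Basis. - of_real ((k \<bullet> b)\<^sup>2)) * ?e x"
    unfolding sum_distrib_right by (intro sum.cong) (auto simp: power2_eq_square mult_ac)
  also have "(\<Sum>b\<in>Basis. - of_real ((k \<bullet> b)\<^sup>2) :: complex) = - of_real ((norm k)\<^sup>2)"
    unfolding power2_norm_eq_inner euclidean_inner[of k k] by (simp add: sum_negf power2_eq_square)
  finally show ?thesis
    by (simp add: wave)
qed

lemma norm_discrete_plane_wave: "cmod (discrete_plane_wave \<tau> k \<omega> n x) = 1"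
  unfolding discrete_plane_wave_def by simp

lemma discrete_plane_wave_Suc:
  "discrete_plane_wave \<tau> k \<omega> (Suc n) x = cis (- (\<omega> * \<tau>)) * discrete_plane_wave \<tau> k \<omega> n x"
  unfolding discrete_plane_wave_def cis_conv_exp
  by (simp add: algebra_simps flip: exp_add)

lemma discrete_plane_wave_diff_1:
  assumes "n \<ge> 1"
  shows "discrete_plane_wave \<tau> k \<omega> (n - 1) x = cis (\<omega> * \<tau>) * discrete_plane_wave \<tau> k \<omega> n x"
proof -
  obtain m where "n = Suc m"
    using assms by (cases n) auto
  then show ?thesis
    by (simp add: discrete_plane_wave_Suc cis_mult flip: mult.assoc)
qed

text \<open>The half-angle factor \<open>1 + exp (2 \<i> \<theta>) = 2 cos \<theta> exp (\<i> \<theta>)\<close>, in modulus.\<close>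

lemma cmod_one_plus_cis_power2: "(cmod (1 + cis t))\<^sup>2 = 4 * (cos (t / 2))\<^sup>2"
proof -
  have "(cmod (1 + cis t))\<^sup>2 = (1 + cos t)\<^sup>2 + (sin t)\<^sup>2"
    by (simp add: cmod_power2)
  also have "\<dots> = 2 + 2 * cos t"
    using sin_cos_squared_add[of t] by (simp add: power2_eq_square algebra_simps)
  also have "\<dots> = 4 * (cos (t / 2))\<^sup>2"
    using cos_double_cos[of "t / 2"] by simp
  finally show ?thesis .
qed

text \<open>At every step and point the scheme, after division by the nonzero value of the wave, is the same
  real equation; this is where the spurious factor \<open>cos (\<omega> \<tau> / 2)\<close> appears on both sides.\<close>

lemma leapfrog_discrete_plane_wave_iff:
  fixes k :: "'a::euclidean_space"
  shows "leapfrog_scheme lam \<tau> (discrete_plane_wave \<tau> k \<omega>) \<longleftrightarrow>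
    2 / \<tau> * sin (\<omega> * \<tau> / 2) * cos (\<omega> * \<tau> / 2) =
    ((norm k)\<^sup>2 + lam * (cos (\<omega> * \<tau> / 2))\<^sup>2) * cos (\<omega> * \<tau> / 2) * cos (\<omega> * \<tau> / 2)"
    (is "_ \<longleftrightarrow> ?L = ?R")
proof -
  let ?u = "discrete_plane_wave \<tau> k \<omega>"
  let ?c = "cos (\<omega> * \<tau> / 2)"
  let ?z = "cis (\<omega> * \<tau>)" and ?z' = "cis (- (\<omega> * \<tau>))"
  have sub: "?z' - ?z = - 2 * \<i> * of_real (sin (\<omega> * \<tau>))"
    by (simp add: complex_eq_iff)
  have add: "?z' + 2 + ?z = of_real (4 * ?c\<^sup>2)"
    using cos_double_cos[of "\<omega> * \<tau> / 2"] by (simp add: complex_eq_iff)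
  have sin: "sin (\<omega> * \<tau>) = 2 * sin (\<omega> * \<tau> / 2) * ?c"
    using sin_double[of "\<omega> * \<tau> / 2"] by simp
  have step: "(\<i> / (2 * of_real \<tau>) * (?u (n + 1) x - ?u (n - 1) x) =
        - (1 / 4) * (laplacian (?u (n + 1)) x + 2 * laplacian (?u n) x + laplacian (?u (n - 1)) x)
        + of_real (lam / 8)
            * of_real ((cmod ((?u n x + ?u (n - 1) x) / 2))\<^sup>2 + (cmod ((?u (n + 1) x + ?u n x) / 2))\<^sup>2)
            * (?u (n + 1) x + 2 * ?u n x + ?u (n - 1) x)) \<longleftrightarrow> ?L = ?R"
    (is "?lhs = ?lap + ?cubic \<longleftrightarrow> _") if n: "n \<ge> 1" for n x
  proof -
    let ?w = "?u n x"
    have next_wave: "?u (n + 1) x = ?z' * ?w" and prev_wave: "?u (n - 1) x = ?z * ?w"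
      using discrete_plane_wave_Suc discrete_plane_wave_diff_1[OF n] by auto
    have nonzero: "?w \<noteq> 0"
      using norm_discrete_plane_wave[of \<tau> k \<omega> n x] by auto
    have average: "?u (n + 1) x + 2 * ?w + ?u (n - 1) x = of_real (4 * ?c\<^sup>2) * ?w"
      unfolding next_wave prev_wave add[symmetric] by (simp add: algebra_simps)
    have "?lhs = \<i> / (2 * of_real \<tau>) * ((?z' - ?z) * ?w)"
      by (simp only: next_wave prev_wave left_diff_distrib)
    also have "\<dots> = of_real ?L * ?w"
      unfolding sub sin by simp
    finally have lhs: "?lhs = of_real ?L * ?w" .
    have "?lap = of_real ((norm k)\<^sup>2 / 4) * (?u (n + 1) x + 2 * ?w + ?u (n - 1) x)"
      unfolding laplacian_discrete_plane_wave by (simp add: algebra_simps)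
    also have "\<dots> = of_real ((norm k)\<^sup>2 * ?c\<^sup>2) * ?w"
      unfolding average by simp
    finally have lap: "?lap = of_real ((norm k)\<^sup>2 * ?c\<^sup>2) * ?w" .
    have "?w + ?u (n - 1) x = (1 + ?z) * ?w" "?u (n + 1) x + ?w = (1 + ?z') * ?w"
      unfolding next_wave prev_wave by (simp_all add: distrib_right)
    then have "(cmod ((?w + ?u (n - 1) x) / 2))\<^sup>2 = ?c\<^sup>2" "(cmod ((?u (n + 1) x + ?w) / 2))\<^sup>2 = ?c\<^sup>2"
      using cmod_one_plus_cis_power2[of "\<omega> * \<tau>"] cmod_one_plus_cis_power2[of "- (\<omega> * \<tau>)"]
      by (simp_all add: norm_mult norm_divide norm_discrete_plane_wave power_divide)
    then have cubic: "?cubic = of_real (lam * ?c\<^sup>2 * ?c\<^sup>2) * ?w"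
      unfolding average by simp
    have "?lap + ?cubic = of_real ?R * ?w"
      unfolding lap cubic by (simp add: power2_eq_square algebra_simps)
    then have "?lhs = ?lap + ?cubic \<longleftrightarrow> of_real ?L * ?w = of_real ?R * ?w"
      by (simp only: lhs)
    also have "\<dots> \<longleftrightarrow> ?L = ?R"
      using nonzero by (simp only: mult_cancel_right of_real_eq_iff) blast
    finally show ?thesis .
  qed
  then show ?thesis
    unfolding leapfrog_scheme_def by blast
qed

theorem lemma6p2:
  fixes lam \<tau> :: real
  assumes "lam = 1 \<or> lam = -1"
    and "\<tau> > 0"
  shows "{(k :: 'a::euclidean_space, \<omega>).
            (k, \<omega>) \<in> numerical_dispersion_relation (leapfrog_scheme lam \<tau>) \<tau> \<and> cos (\<omega> * \<tau> / 2) \<noteq> 0} =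
         {(k, \<omega>). 2 / \<tau> * sin (\<omega> * \<tau> / 2)
            = ((norm k)\<^sup>2 + lam * (cos (\<omega> * \<tau> / 2))\<^sup>2) * cos (\<omega> * \<tau> / 2)}
       \<and> {(k :: 'a, \<omega>). cos (\<omega> * \<tau> / 2) = 0}
         \<subseteq> numerical_dispersion_relation (leapfrog_scheme lam \<tau>) \<tau>"
proof -
  have mem: "(k, \<omega>) \<in> numerical_dispersion_relation (leapfrog_scheme lam \<tau>) \<tau> \<longleftrightarrow>
      2 / \<tau> * sin (\<omega> * \<tau> / 2) * cos (\<omega> * \<tau> / 2) =
      ((norm k)\<^sup>2 + lam * (cos (\<omega> * \<tau> / 2))\<^sup>2) * cos (\<omega> * \<tau> / 2) * cos (\<omega> * \<tau> / 2)"
    for k :: 'a and \<omega>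
    unfolding numerical_dispersion_relation_def by (simp add: leapfrog_discrete_plane_wave_iff)
  \<comment> \<open>The dispersion relation with \<open>cos = 0\<close> would force \<open>sin = 0\<close> as well.\<close>
  have cos_nonzero: "cos (\<omega> * \<tau> / 2) \<noteq> 0"
    if "2 / \<tau> * sin (\<omega> * \<tau> / 2) = ((norm k)\<^sup>2 + lam * (cos (\<omega> * \<tau> / 2))\<^sup>2) * cos (\<omega> * \<tau> / 2)"
    for k :: 'a and \<omega>
  proof
    assume zero: "cos (\<omega> * \<tau> / 2) = 0"
    then have "sin (\<omega> * \<tau> / 2) = 0"
      using that assms(2) by simp
    then show False
      using zero sin_cos_squared_add[of "\<omega> * \<tau> / 2"] by simp
  qed
  have "(k, \<omega>) \<in> numerical_dispersion_relation (leapfrog_scheme lam \<tau>) \<tau> \<and> cos (\<omega> * \<tau> / 2) \<noteq> 0 \<longleftrightarrow>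
      2 / \<tau> * sin (\<omega> * \<tau> / 2) = ((norm k)\<^sup>2 + lam * (cos (\<omega> * \<tau> / 2))\<^sup>2) * cos (\<omega> * \<tau> / 2)"
    for k :: 'a and \<omega>
    unfolding mem mult_cancel_right using cos_nonzero[of \<omega> k] by blast
  moreover have "(k, \<omega>) \<in> numerical_dispersion_relation (leapfrog_scheme lam \<tau>) \<tau>"
    if "cos (\<omega> * \<tau> / 2) = 0" for k :: 'a and \<omega>
    unfolding mem that by simp
  ultimately show ?thesis
    by auto
qed

end
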